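(* Let $(b,c)$ be a connected graph over the countably infinite set $X$ that is both quasi-vertex-transitive and transient. Then $(b,c)$ is uniformly transient.
   Context: $X$ is a countably infinite set, $C(X)$ the real-valued functions on $X$, $C_c(X)$ those with finite support, $\|f\|_\infty=\sup_X|f|$, and $C_0(X)$ is the closure of $C_c(X)$ with respect to $\|\cdot\|_\infty$. A graph $(b,c)$ over $X$ consists of a symmetric $b:X\times X\to[0,\infty)$ with zero diagonal and $\sum_{y}b(x,y)<\infty$ for all $x$, and an arbitrary $c:X\to[0,\infty)$. It is connected if for any two distinct $x,y\in X$ there are $x=x_0,\dots,x_n=y$ with $b(x_{i-1},x_i)>0$ for $i=1,\dots,n$. For $f\in C(X)$ put $\widetilde Q(f)=\frac12\sum_{x,y}b(x,y)|f(x)-f(y)|^2+\sum_x c(x)|f(x)|^2\in[0,\infty]$ and $\widetilde D=\{f\in C(X):\widetilde Q(f)<\infty\}$. For $o\in X$ put $\|f\|_o=(\widetilde Q(f)+|f(o)|^2)^{1/2}$; $\widetilde D_0$ is the closure of $C_c(X)$ in $\widetilde D$ with respect to $\|\cdot\|_o$ (independent of $o$ for connected graphs). A connected graph is recurrent if $1\in\widetilde D_0$ and $\widetilde Q(1)=0$, and transient otherwise. It is uniformly transient if $\widetilde D_0\subseteq C_0(X)$; equivalently, there is $C\ge0$ with $\|\varphi\|_\infty\le C\widetilde Q^{1/2}(\varphi)$ for all $\varphi\in C_c(X)$. The graph is quasi-vertex-transitive if there are $n\in\mathbb N$ and vertices $x_1,\dots,x_n$ such that for every $y\in X$ there exist $j\in\{1,\dots,n\}$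 and a bijection $h:X\to X$ with $h(y)=x_j$, $c(h(z))=c(z)$ and $b(h(v),h(w))=b(v,w)$ for all $z,v,w\in X$. *)

theory Defs
  imports "HOL-Analysis.Analysis"
begin

text \<open>
  The vertex set is the whole type \<open>'v\<close>; that it is countably infinite is an explicit
  hypothesis wherever it is needed.
\<close>

locale weighted_graph =
  fixes b :: "'v \<Rightarrow> 'v \<Rightarrow> real" and c :: "'v \<Rightarrow> real"
  assumes b_nonneg: "0 \<le> b x y"
    and b_sym: "b x y = b y x"
    and b_diag: "b x x = 0"
    and b_summable: "(\<lambda>y. b x y) summable_on UNIV"
    and c_nonneg: "0 \<le> c x"

definition graph_connected :: "('v \<Rightarrow> 'v \<Rightarrow> real) \<Rightarrow> bool" where
  "graph_connected b \<longleftrightarrow> (\<forall>x y. x \<noteq> y \<longrightarrow> (\<lambda>u v. b u v > 0)\<^sup>*\<^sup>* x y)"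

definition Cc :: "('v \<Rightarrow> real) set" where
  "Cc = {f. finite {x. f x \<noteq> 0}}"

text \<open>The supremum norm takes the value \<open>\<infinity>\<close> on unbounded functions.\<close>

definition sup_norm :: "('v \<Rightarrow> real) \<Rightarrow> ennreal" where
  "sup_norm f = (SUP x. ennreal \<bar>f x\<bar>)"

definition C0 :: "('v \<Rightarrow> real) set" where
  "C0 = {f. \<forall>e::real. e > 0 \<longrightarrow> (\<exists>\<phi>\<in>Cc. sup_norm (\<lambda>x. f x - \<phi> x) < ennreal e)}"

definition energy :: "('v \<Rightarrow> 'v \<Rightarrow> real) \<Rightarrow> ('v \<Rightarrow> real) \<Rightarrow> ('v \<Rightarrow> real) \<Rightarrow> ennreal" where
  "energy b c f =
     (\<Sum>\<^sub>\<infinity>(x, y)\<in>UNIV. ennreal (b x y * \<bar>f x - f y\<bar>\<^sup>2)) / 2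
     + (\<Sum>\<^sub>\<infinity>x\<in>UNIV. ennreal (c x * \<bar>f x\<bar>\<^sup>2))"

definition finite_energy :: "('v \<Rightarrow> 'v \<Rightarrow> real) \<Rightarrow> ('v \<Rightarrow> real) \<Rightarrow> ('v \<Rightarrow> real) set" where
  "finite_energy b c = {f. energy b c f < \<infinity>}"

text \<open>
  The norm with base point \<open>p\<close>. It is only meaningful on functions of finite energy, because
  \<^const>\<open>enn2real\<close> sends \<open>\<infinity>\<close> to \<open>0\<close>. Below it is only applied to such functions: for a weighted
  graph, \<^term>\<open>finite_energy b c\<close> is a vector space containing \<^const>\<open>Cc\<close>.
\<close>

definition base_norm ::
    "('v \<Rightarrow> 'v \<Rightarrow> real) \<Rightarrow> ('v \<Rightarrow> real) \<Rightarrow> 'v \<Rightarrow> ('v \<Rightarrow> real) \<Rightarrow> real" where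
  "base_norm b c p f = sqrt (enn2real (energy b c f) + \<bar>f p\<bar>\<^sup>2)"

text \<open>
  The closure of \<^const>\<open>Cc\<close> in \<^term>\<open>finite_energy b c\<close>. For connected graphs it does not depend
  on the base point \<open>p\<close>.
\<close>

definition finite_energy0 ::
    "('v \<Rightarrow> 'v \<Rightarrow> real) \<Rightarrow> ('v \<Rightarrow> real) \<Rightarrow> 'v \<Rightarrow> ('v \<Rightarrow> real) set" where
  "finite_energy0 b c p =
     {f \<in> finite_energy b c. \<forall>e>0. \<exists>\<phi>\<in>Cc. base_norm b c p (\<lambda>x. f x - \<phi> x) < e}"

definition recurrent :: "('v \<Rightarrow> 'v \<Rightarrow> real) \<Rightarrow> ('v \<Rightarrow> real) \<Rightarrow> 'v \<Rightarrow> bool" where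
  "recurrent b c p \<longleftrightarrow> (\<lambda>_. 1) \<in> finite_energy0 b c p \<and> energy b c (\<lambda>_. 1) = 0"

definition transient :: "('v \<Rightarrow> 'v \<Rightarrow> real) \<Rightarrow> ('v \<Rightarrow> real) \<Rightarrow> 'v \<Rightarrow> bool" where
  "transient b c p \<longleftrightarrow> \<not> recurrent b c p"

definition uniformly_transient :: "('v \<Rightarrow> 'v \<Rightarrow> real) \<Rightarrow> ('v \<Rightarrow> real) \<Rightarrow> 'v \<Rightarrow> bool" where
  "uniformly_transient b c p \<longleftrightarrow> finite_energy0 b c p \<subseteq> C0"

definition graph_automorphism ::
    "('v \<Rightarrow> 'v \<Rightarrow> real) \<Rightarrow> ('v \<Rightarrow> real) \<Rightarrow> ('v \<Rightarrow> 'v) \<Rightarrow> bool" where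
  "graph_automorphism b c h \<longleftrightarrow>
     bij h \<and> (\<forall>z. c (h z) = c z) \<and> (\<forall>v w. b (h v) (h w) = b v w)"

definition quasi_vertex_transitive :: "('v \<Rightarrow> 'v \<Rightarrow> real) \<Rightarrow> ('v \<Rightarrow> real) \<Rightarrow> bool" where
  "quasi_vertex_transitive b c \<longleftrightarrow>
     (\<exists>(n::nat) x. \<forall>y. \<exists>j\<in>{1..n}. \<exists>h. graph_automorphism b c h \<and> h y = x j)"

end

theory Submission
  imports Defs
begin

text \<open>
  If no inequality \<open>\<bar>\<phi> p\<bar>\<^sup>2 \<le> C Q(\<phi>)\<close> holds on \<^const>\<open>Cc\<close>, normalising \<open>\<phi> p = 1\<close> gives
  \<open>\<phi>\<close> of arbitrarily small energy. Along paths the energy controls differences of values, so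
  the killing term \<open>c\<close> vanishes and these \<open>\<phi>\<close> converge to \<open>1\<close> in the base point norm:
  the graph is recurrent. Hence a transient graph satisfies such an inequality at every vertex,
  and automorphisms make the constant depend only on one of finitely many orbits. The
  resulting uniform bound passes from \<^const>\<open>Cc\<close> to its closure, and so forces
  approximation in the base point norm to be approximation in the supremum norm.
\<close>

section \<open>Sums in \<open>ennreal\<close> and an inequality for squares\<close>

lemma ennreal_summable_on [simp]: "(f :: 'a \<Rightarrow> ennreal) summable_on S"
  by (rule nonneg_summable_on_complete) simp

lemma infsum_ennreal_cmult:
  fixes f :: "'a \<Rightarrow> ennreal"
  shows "(\<Sum>\<^sub>\<infinity>x\<in>S. a * f x) = a * (\<Sum>\<^sub>\<infinity>x\<in>S. f x)"
proof -
  have "(\<Sum>\<^sub>\<infinity>x\<in>S. a * f x) = (SUP F\<in>{F. finite F \<and> F \<subseteq> S}. a * sum f F)"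
    by (subst nonneg_infsum_complete) (auto simp: sum_distrib_left)
  also have "\<dots> = a * (SUP F\<in>{F. finite F \<and> F \<subseteq> S}. sum f F)"
    by (subst SUP_mult_left_ennreal) auto
  finally show ?thesis
    by (subst (asm) nonneg_infsum_complete[symmetric]) auto
qed

lemma infsum_ennreal_eq:
  fixes f :: "'a \<Rightarrow> real"
  assumes "f summable_on S" and "\<And>x. 0 \<le> f x"
  shows "(\<Sum>\<^sub>\<infinity>x\<in>S. ennreal (f x)) = ennreal (infsum f S)"
proof -
  have "(\<Sum>\<^sub>\<infinity>x\<in>S. ennreal (f x)) = (SUP F\<in>{F. finite F \<and> F \<subseteq> S}. ennreal (sum f F))"
    by (subst nonneg_infsum_complete) (auto simp: assms(2) sum_ennreal)
  then show ?thesis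
    using infsum_nonneg_is_SUPREMUM_ennreal[of f S] assms by simp
qed

lemma infsum_ennreal_ge:
  fixes f :: "'a \<Rightarrow> ennreal"
  assumes "x \<in> S"
  shows "f x \<le> infsum f S"
proof -
  have "infsum f {x} \<le> infsum f S"
    using assms by (intro infsum_mono_neutral) auto
  then show ?thesis by simp
qed

lemma ennreal_double_half: "2 * (d / 2) = (d :: ennreal)"
proof -
  have "2 * (d / 2) = d * 2 / 2"
    by (subst mult.commute[of d 2]) (rule ennreal_times_divide)
  then show ?thesis
    by (simp add: mult_divide_eq_ennreal)
qed

text \<open>The two sides differ by a square. This is the triangle inequality for squared distances:
  all later estimates stay with squares, at the price of a factor 2 per use. Instantiations list the
  intermediate point \<open>v\<close> last.\<close>

lemma square_diff_le: "(u - w)\<^sup>2 \<le> 2 * (u - v)\<^sup>2 + 2 * (v - w)\<^sup>2" for u v w :: real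
proof -
  have "2 * (u - v)\<^sup>2 + 2 * (v - w)\<^sup>2 - (u - w)\<^sup>2 = ((u - v) - (v - w))\<^sup>2"
    by (simp add: power2_eq_square algebra_simps)
  then show ?thesis
    by (metis diff_ge_0_iff_ge zero_le_power2)
qed

section \<open>Invariance of the energy and approximation in the base point norm\<close>

abbreviation real_energy ::
    "('v \<Rightarrow> 'v \<Rightarrow> real) \<Rightarrow> ('v \<Rightarrow> real) \<Rightarrow> ('v \<Rightarrow> real) \<Rightarrow> real" where
  "real_energy b c f \<equiv> enn2real (energy b c f)"

text \<open>Reindex the sum over vertices by \<open>h\<close> and the sum over pairs by
  \<open>map_prod h h\<close>.\<close>

lemma energy_automorphism:
  assumes "graph_automorphism b c h"
  shows "energy b c (f \<circ> h) = energy b c f"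
proof -
  from assms have h: "bij h" "\<And>z. c (h z) = c z" "\<And>v w. b (h v) (h w) = b v w"
    by (auto simp: graph_automorphism_def)
  have "bij_betw (map_prod h h) UNIV UNIV"
    using bij_betw_map_prod[OF h(1) h(1)] by simp
  from infsum_reindex_bij_betw[OF this, of "\<lambda>(x, y). ennreal (b x y * \<bar>f x - f y\<bar>\<^sup>2)"]
    infsum_reindex_bij_betw[OF h(1), of "\<lambda>x. ennreal (c x * \<bar>f x\<bar>\<^sup>2)"]
  show ?thesis
    by (simp add: energy_def h case_prod_unfold)
qed

text \<open>The definition of the closure at \<open>sqrt e\<close> bounds the squared norm by
  \<open>e\<close>, hence each of its two nonnegative summands.\<close>

lemma finite_energy0_approx:
  assumes "f \<in> finite_energy0 b c p" and "0 < e"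
  obtains \<phi> where "\<phi> \<in> Cc" and "real_energy b c (\<lambda>x. f x - \<phi> x) < e"
    and "(f p - \<phi> p)\<^sup>2 < e"
proof -
  have "0 < sqrt e" using assms(2) by simp
  with assms(1) obtain \<phi> where \<phi>: "\<phi> \<in> Cc" "base_norm b c p (\<lambda>x. f x - \<phi> x) < sqrt e"
    unfolding finite_energy0_def by blast
  then have "real_energy b c (\<lambda>x. f x - \<phi> x) + (f p - \<phi> p)\<^sup>2 < e"
    by (simp add: base_norm_def)
  moreover have "0 \<le> real_energy b c (\<lambda>x. f x - \<phi> x)" "0 \<le> (f p - \<phi> p)\<^sup>2"
    by simp_all
  ultimately show ?thesis
    using \<phi>(1) by (intro that[of \<phi>]) linarith+
qed

context weighted_graph
begin

section \<open>The vector space of functions of finite energy\<close>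

text \<open>The energy is a sum of squares with nonnegative weights, so quadratic domination of
  values and of differences carries over term by term. Differences and multiples of functions are
  both special cases.\<close>

lemma energy_le:
  assumes AB: "0 \<le> A" "0 \<le> B"
    and diff: "\<And>x y. (f x - f y)\<^sup>2 \<le> A * (g x - g y)\<^sup>2 + B * (h x - h y)\<^sup>2"
    and val: "\<And>x. (f x)\<^sup>2 \<le> A * (g x)\<^sup>2 + B * (h x)\<^sup>2"
  shows "energy b c f \<le> ennreal A * energy b c g + ennreal B * energy b c h"
proof -
  have weighted: "ennreal (w * s\<^sup>2) \<le> ennreal A * ennreal (w * t\<^sup>2) + ennreal B * ennreal (w * u\<^sup>2)"
    if "0 \<le> w" "s\<^sup>2 \<le> A * t\<^sup>2 + B * u\<^sup>2" for w s t u
  proof -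
    have "w * s\<^sup>2 \<le> A * (w * t\<^sup>2) + B * (w * u\<^sup>2)"
      using mult_left_mono[OF that(2,1)] by (simp add: algebra_simps)
    then have "ennreal (w * s\<^sup>2) \<le> ennreal (A * (w * t\<^sup>2) + B * (w * u\<^sup>2))"
      by (rule ennreal_leI)
    then show ?thesis using AB that(1)
      by (simp add: ennreal_plus ennreal_mult)
  qed
  let ?D = "\<lambda>f. \<Sum>\<^sub>\<infinity>(x, y)\<in>UNIV. ennreal (b x y * \<bar>f x - f y\<bar>\<^sup>2)"
  let ?V = "\<lambda>f. \<Sum>\<^sub>\<infinity>x\<in>UNIV. ennreal (c x * \<bar>f x\<bar>\<^sup>2)"
  have D: "?D f \<le> ennreal A * ?D g + ennreal B * ?D h"
    unfolding infsum_ennreal_cmult[symmetric]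
    by (subst infsum_add[symmetric])
      (auto intro!: infsum_mono weighted b_nonneg diff)
  have V: "?V f \<le> ennreal A * ?V g + ennreal B * ?V h"
    unfolding infsum_ennreal_cmult[symmetric]
    by (subst infsum_add[symmetric])
      (auto intro!: infsum_mono weighted c_nonneg val)
  have "energy b c f \<le> (ennreal A * ?D g + ennreal B * ?D h) / 2 + (ennreal A * ?V g + ennreal B * ?V h)"
    unfolding energy_def by (intro add_mono divide_right_mono_ennreal D V)
  also have "\<dots> = ennreal A * energy b c g + ennreal B * energy b c h"
    by (simp add: energy_def add_divide_distrib_ennreal ennreal_times_divide distrib_left ac_simps)
  finally show ?thesis .
qed

text \<open>Membership belongs to the conclusion: \<open>enn2real\<close> sends infinity to 0, so
  the real inequality alone would not exclude infinite energy of \<open>f\<close>.\<close>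

lemma real_energy_le:
  assumes "0 \<le> A" "0 \<le> B" "g \<in> finite_energy b c" "h \<in> finite_energy b c"
    and "\<And>x y. (f x - f y)\<^sup>2 \<le> A * (g x - g y)\<^sup>2 + B * (h x - h y)\<^sup>2"
    and "\<And>x. (f x)\<^sup>2 \<le> A * (g x)\<^sup>2 + B * (h x)\<^sup>2"
  shows "f \<in> finite_energy b c"
    and "real_energy b c f \<le> A * real_energy b c g + B * real_energy b c h"
proof -
  have fin: "energy b c g < \<infinity>" "energy b c h < \<infinity>"
    using assms(3,4) by (auto simp: finite_energy_def)
  have "energy b c f \<le> ennreal A * energy b c g + ennreal B * energy b c h"
    using assms by (intro energy_le)
  also have "\<dots> = ennreal (A * real_energy b c g + B * real_energy b c h)"
    using fin assms(1,2) by (simp add: ennreal_plus ennreal_mult)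
  finally have le: "energy b c f \<le> ennreal (A * real_energy b c g + B * real_energy b c h)" .
  then show "f \<in> finite_energy b c"
    by (auto simp: finite_energy_def intro: le_less_trans)
  show "real_energy b c f \<le> A * real_energy b c g + B * real_energy b c h"
    using enn2real_mono[OF le] assms(1,2) by (simp add: enn2real_ennreal del: ennreal_plus)
qed

lemma finite_energy_diff:
  assumes "f \<in> finite_energy b c" "g \<in> finite_energy b c"
  shows "(\<lambda>x. f x - g x) \<in> finite_energy b c"
    and "real_energy b c (\<lambda>x. f x - g x) \<le> 2 * real_energy b c f + 2 * real_energy b c g"
proof -
  have diff: "((f x - g x) - (f y - g y))\<^sup>2 \<le> 2 * (f x - f y)\<^sup>2 + 2 * (g x - g y)\<^sup>2" for x y
    using square_diff_le[of "f x - f y" "g x - g y" 0] by (simp add: algebra_simps power2_commute[of "g y"])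
  have val: "(f x - g x)\<^sup>2 \<le> 2 * (f x)\<^sup>2 + 2 * (g x)\<^sup>2" for x
    using square_diff_le[of "f x" "g x" 0] by simp
  show "(\<lambda>x. f x - g x) \<in> finite_energy b c"
    and "real_energy b c (\<lambda>x. f x - g x) \<le> 2 * real_energy b c f + 2 * real_energy b c g"
    using real_energy_le[OF _ _ assms diff val] by auto
qed

lemma finite_energy_scale:
  assumes "f \<in> finite_energy b c"
  shows "(\<lambda>x. a * f x) \<in> finite_energy b c"
    and "real_energy b c (\<lambda>x. a * f x) \<le> a\<^sup>2 * real_energy b c f"
  using real_energy_le[of "a\<^sup>2" 0 f f "\<lambda>x. a * f x"] assms
  by (simp_all add: power_mult_distrib flip: right_diff_distrib)

text \<open>Only edges at \<open>z\<close> contribute. The sum over pairs is at most the row sum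
  plus the column sum at \<open>z\<close>; these agree by symmetry and are finite by
  summability.\<close>

lemma indicator_finite_energy: "(indicator {z} :: 'v \<Rightarrow> real) \<in> finite_energy b c"
proof -
  let ?i = "indicator {z} :: 'v \<Rightarrow> real"
  let ?b = "ennreal (infsum (b z) UNIV)"
  have row: "(\<Sum>\<^sub>\<infinity>y\<in>UNIV. ennreal (b z y)) = ?b"
    by (rule infsum_ennreal_eq) (use b_summable b_nonneg in auto)
  have "(\<Sum>\<^sub>\<infinity>(x, y)\<in>UNIV. ennreal (b x y * ?i x)) = (\<Sum>\<^sub>\<infinity>(x, y)\<in>Pair z ` UNIV. ennreal (b x y))"
    by (rule infsum_cong_neutral) (auto simp: indicator_def)
  also have "\<dots> = ?b"
    by (subst infsum_reindex) (auto simp: inj_on_def o_def row)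
  finally have r: "(\<Sum>\<^sub>\<infinity>(x, y)\<in>UNIV. ennreal (b x y * ?i x)) = ?b" .
  have "(\<Sum>\<^sub>\<infinity>(x, y)\<in>UNIV. ennreal (b x y * ?i y)) = (\<Sum>\<^sub>\<infinity>(x, y)\<in>(\<lambda>y. (y, z)) ` UNIV. ennreal (b x y))"
    by (rule infsum_cong_neutral) (auto simp: indicator_def)
  also have "\<dots> = ?b"
    by (subst infsum_reindex) (auto simp: inj_on_def o_def row b_sym[of _ z])
  finally have l: "(\<Sum>\<^sub>\<infinity>(x, y)\<in>UNIV. ennreal (b x y * ?i y)) = ?b" .
  have "(\<Sum>\<^sub>\<infinity>(x, y)\<in>UNIV. ennreal (b x y * \<bar>?i x - ?i y\<bar>\<^sup>2))
      \<le> (\<Sum>\<^sub>\<infinity>q\<in>UNIV. (case q of (x, y) \<Rightarrow> ennreal (b x y * ?i x)) + (case q of (x, y) \<Rightarrow> ennreal (b x y * ?i y)))"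
    by (rule infsum_mono) (auto simp: indicator_def)
  also have "\<dots> = ?b + ?b"
    by (subst infsum_add) (simp_all add: l r)
  finally have D: "(\<Sum>\<^sub>\<infinity>(x, y)\<in>UNIV. ennreal (b x y * \<bar>?i x - ?i y\<bar>\<^sup>2)) < \<infinity>"
    by (rule le_less_trans) simp
  have "(\<Sum>\<^sub>\<infinity>x\<in>UNIV. ennreal (c x * \<bar>?i x\<bar>\<^sup>2)) = (\<Sum>\<^sub>\<infinity>x\<in>{z}. ennreal (c x))"
    by (rule infsum_cong_neutral) auto
  then show ?thesis
    using D by (auto simp: finite_energy_def energy_def ennreal_divide_eq_top_iff simp flip: less_top)
qed

lemma Cc_subset_finite_energy: "Cc \<subseteq> finite_energy b c"
proof
  fix f :: "'v \<Rightarrow> real"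
  have "f \<in> finite_energy b c" if "finite S" "\<And>x. x \<notin> S \<Longrightarrow> f x = 0" for S f
    using that
  proof (induction S arbitrary: f rule: finite_induct)
    case empty
    then show ?case
      by (simp add: finite_energy_def energy_def case_prod_unfold)
  next
    case (insert z S)
    have "f(z := 0) \<in> finite_energy b c"
      by (rule insert.IH) (use insert.prems in auto)
    \<comment> \<open>Adding \<open>f z\<close> times the indicator of \<open>z\<close> restores
      \<open>f\<close>. The factor \<open>- f z\<close> turns this addition into a
      difference.\<close>
    from finite_energy_diff(1)[OF this finite_energy_scale(1)[OF indicator_finite_energy[of z], of "- f z"]]
    show ?case
      by (rule arg_cong2[where f = "(\<in>)", THEN iffD1, rotated 2]) (auto simp: indicator_def)
  qed
  then show "f \<in> Cc \<Longrightarrow> f \<in> finite_energy b c"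
    by (auto simp: Cc_def)
qed

section \<open>Pointwise control by the energy\<close>

text \<open>A single term is kept from the sum over ordered pairs; the factor 2 undoes the halving
  in \<open>energy\<close>.\<close>

lemma edge_bound:
  assumes "f \<in> finite_energy b c"
  shows "b x y * (f x - f y)\<^sup>2 \<le> 2 * real_energy b c f"
proof -
  let ?D = "\<Sum>\<^sub>\<infinity>(x, y)\<in>UNIV. ennreal (b x y * \<bar>f x - f y\<bar>\<^sup>2)"
  have "ennreal (b x y * (f x - f y)\<^sup>2) \<le> ?D"
    using infsum_ennreal_ge[of "(x, y)" UNIV "\<lambda>(x, y). ennreal (b x y * \<bar>f x - f y\<bar>\<^sup>2)"] by simp
  also have "?D = 2 * (?D / 2)"
    by (rule ennreal_double_half[symmetric])
  also have "\<dots> \<le> 2 * energy b c f"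
    unfolding energy_def by (intro mult_left_mono) auto
  also have "\<dots> = ennreal (2 * real_energy b c f)"
    using assms by (simp add: finite_energy_def ennreal_mult)
  finally show ?thesis
    by (simp add: ennreal_le_iff)
qed

lemma killing_bound:
  assumes "f \<in> finite_energy b c"
  shows "c x * (f x)\<^sup>2 \<le> real_energy b c f"
proof -
  have "ennreal (c x * (f x)\<^sup>2) \<le> energy b c f"
    using infsum_ennreal_ge[of x UNIV "\<lambda>x. ennreal (c x * \<bar>f x\<bar>\<^sup>2)"]
    unfolding energy_def by (simp add: add_increasing)
  also have "\<dots> = ennreal (real_energy b c f)"
    using assms by (simp add: finite_energy_def)
  finally show ?thesis
    by (simp add: ennreal_le_iff)
qed

text \<open>Edge bounds are chained along a path from \<open>x\<close> to \<open>y\<close>. The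
  constant depends on the path but not on \<open>f\<close>.\<close>

lemma path_bound:
  assumes "graph_connected b"
  obtains K where "0 \<le> K"
    and "\<And>f. f \<in> finite_energy b c \<Longrightarrow> (f x - f y)\<^sup>2 \<le> K * real_energy b c f"
proof -
  have "(\<lambda>u v. b u v > 0)\<^sup>*\<^sup>* x y"
    using assms by (cases "x = y") (auto simp: graph_connected_def)
  then have "\<exists>K\<ge>0. \<forall>f\<in>finite_energy b c. (f x - f y)\<^sup>2 \<le> K * real_energy b c f"
  proof (induction rule: rtranclp_induct)
    case base
    show ?case by (intro exI[of _ 0]) auto
  next
    case (step y z)
    then obtain K where K: "0 \<le> K" "\<forall>f\<in>finite_energy b c. (f x - f y)\<^sup>2 \<le> K * real_energy b c f"
      by blast
    \<comment> \<open>Both summands are doubled by \<open>square_diff_le\<close>: the old constant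
      \<open>K\<close> and the edge constant \<open>2 / b y z\<close>.\<close>
    have "(f x - f z)\<^sup>2 \<le> (2 * K + 4 / b y z) * real_energy b c f" if "f \<in> finite_energy b c" for f
    proof -
      have "(f y - f z)\<^sup>2 \<le> 2 / b y z * real_energy b c f"
        using edge_bound[OF that, of y z] \<open>b y z > 0\<close> by (simp add: field_simps)
      moreover have "(f x - f y)\<^sup>2 \<le> K * real_energy b c f"
        using K(2) that by blast
      ultimately show ?thesis
        using square_diff_le[of "f x" "f z" "f y"] by (simp add: algebra_simps)
    qed
    moreover have "0 \<le> 2 * K + 4 / b y z"
      using K(1) \<open>b y z > 0\<close> by simp
    ultimately show ?case by blast
  qed
  then show ?thesis using that by blast
qed

text \<open>The value at \<open>y\<close> is the value at \<open>x\<close> plus a difference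
  controlled by \<open>path_bound\<close>. The set \<open>S\<close> is kept general in order to
  cover both \<open>finite_energy b c\<close> and \<open>Cc\<close>.\<close>

lemma value_bound_transfer:
  assumes "graph_connected b" and "S \<subseteq> finite_energy b c" and "0 \<le> C"
    and "\<And>f. f \<in> S \<Longrightarrow> (f x)\<^sup>2 \<le> C * real_energy b c f"
  obtains C' where "0 \<le> C'" and "\<And>f. f \<in> S \<Longrightarrow> (f y)\<^sup>2 \<le> C' * real_energy b c f"
proof -
  obtain K where K: "0 \<le> K" "\<And>f. f \<in> finite_energy b c \<Longrightarrow> (f y - f x)\<^sup>2 \<le> K * real_energy b c f"
    using path_bound[OF assms(1)] by metis
  have "(f y)\<^sup>2 \<le> (2 * K + 2 * C) * real_energy b c f" if "f \<in> S" for f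
    using square_diff_le[of "f y" 0 "f x"] K(2)[of f] assms(2) assms(4)[OF that] that
    by (auto simp: algebra_simps)
  then show ?thesis
    using K(1) assms(3) by (intro that[of "2 * K + 2 * C"]) auto
qed

section \<open>From transience to a bound uniform in the vertex\<close>

text \<open>If \<open>c x > 0\<close> somewhere, the killing term controls the value at
  \<open>x\<close>, and connectedness carries this to \<open>p\<close>. If \<open>c\<close>
  vanishes, the constant 1 has energy 0, and failure of the bound would put it into the closure of
  \<open>Cc\<close>.\<close>

lemma transient_imp_base_bound:
  assumes conn: "graph_connected b" and "transient b c p"
  obtains C where "0 \<le> C" and "\<And>\<phi>. \<phi> \<in> Cc \<Longrightarrow> (\<phi> p)\<^sup>2 \<le> C * real_energy b c \<phi>"
proof (cases "\<exists>x. c x > 0")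
  case True
  then obtain x where x: "c x > 0" by blast
  have "(f x)\<^sup>2 \<le> 1 / c x * real_energy b c f" if "f \<in> finite_energy b c" for f
    using killing_bound[OF that, of x] x by (simp add: field_simps)
  from value_bound_transfer[OF conn order.refl _ this] x
  obtain C where "0 \<le> C" "\<And>f. f \<in> finite_energy b c \<Longrightarrow> (f p)\<^sup>2 \<le> C * real_energy b c f"
    by (metis less_imp_le zero_le_divide_1_iff)
  then show ?thesis
    using that Cc_subset_finite_energy by blast
next
  case False
  then have c0: "c x = 0" for x
    using c_nonneg[of x] by (meson order.antisym not_le)
  have E1: "energy b c (\<lambda>_. 1) = 0"
    by (simp add: energy_def c0 case_prod_unfold)
  then have one: "(\<lambda>_. 1) \<in> finite_energy b c"
    by (simp add: finite_energy_def)
  have "\<exists>C\<ge>0. \<forall>\<phi>\<in>Cc. (\<phi> p)\<^sup>2 \<le> C * real_energy b c \<phi>"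
  proof (rule ccontr)
    assume neg: "\<not> ?thesis"
    have "\<exists>\<psi>\<in>Cc. base_norm b c p (\<lambda>x. 1 - \<psi> x) < e" if e: "e > 0" for e
    proof -
      \<comment> \<open>The failing constant is \<open>1 / e\<^sup>2\<close>, so that dividing by
        \<open>\<phi> p\<close> leaves energy below \<open>e\<^sup>2\<close>.\<close>
      obtain \<phi> where \<phi>: "\<phi> \<in> Cc" "(\<phi> p)\<^sup>2 > (1 / e\<^sup>2) * real_energy b c \<phi>"
        using neg e by (metis not_le zero_le_divide_1_iff zero_le_power2)
      have "0 \<le> (1 / e\<^sup>2) * real_energy b c \<phi>" by simp
      then have pos: "0 < (\<phi> p)\<^sup>2"
        using \<phi>(2) by linarith
      define \<psi> where "\<psi> = (\<lambda>x. inverse (\<phi> p) * \<phi> x)"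
      have \<psi>: "\<psi> \<in> Cc"
        using \<phi>(1) by (auto simp: Cc_def \<psi>_def elim: rev_finite_subset)
      have "real_energy b c \<psi> \<le> (inverse (\<phi> p))\<^sup>2 * real_energy b c \<phi>"
        unfolding \<psi>_def using \<phi>(1) Cc_subset_finite_energy by (intro finite_energy_scale(2)) auto
      also have "\<dots> < e\<^sup>2"
        using \<phi>(2) pos e by (simp add: field_simps)
      finally have "real_energy b c \<psi> < e\<^sup>2" .
      moreover have "\<bar>(1 - \<psi> x) - (1 - \<psi> y)\<bar> = \<bar>\<psi> x - \<psi> y\<bar>" for x y
        by simp
      \<comment> \<open>Since \<open>c\<close> vanishes, only differences enter the energy. As
        \<open>1 - \<psi>\<close> is 0 at \<open>p\<close>, its base norm is the square root of the
        energy of \<open>\<psi>\<close>.\<close>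
      then have "energy b c (\<lambda>x. 1 - \<psi> x) = energy b c \<psi>"
        by (simp only: energy_def c0 mult_zero_left)
      moreover have "\<psi> p = 1"
        using pos by (simp add: \<psi>_def)
      ultimately have "base_norm b c p (\<lambda>x. 1 - \<psi> x) < e"
        using e by (simp add: base_norm_def real_less_lsqrt)
      with \<psi> show ?thesis by blast
    qed
    then have "recurrent b c p"
      using one E1 by (simp add: recurrent_def finite_energy0_def)
    with assms(2) show False
      by (simp add: transient_def)
  qed
  then show ?thesis using that by blast
qed

lemma quasi_vertex_transitive_imp_uniform_bound:
  assumes "graph_connected b" and "quasi_vertex_transitive b c" and "transient b c p"
  obtains C where "0 \<le> C" and "\<And>\<phi> x. \<phi> \<in> Cc \<Longrightarrow> (\<phi> x)\<^sup>2 \<le> C * real_energy b c \<phi>"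
proof -
  \<comment> \<open>Here \<open>C0\<close> is a real constant, not the function space of that
    name.\<close>
  obtain C0 where "0 \<le> C0" "\<And>\<phi>. \<phi> \<in> Cc \<Longrightarrow> (\<phi> p)\<^sup>2 \<le> C0 * real_energy b c \<phi>"
    using transient_imp_base_bound[OF assms(1,3)] by blast
  then have "\<exists>C\<ge>0. \<forall>\<phi>\<in>Cc. (\<phi> x)\<^sup>2 \<le> C * real_energy b c \<phi>" for x
    using value_bound_transfer[OF assms(1) Cc_subset_finite_energy] by metis
  then obtain C where C: "\<And>x. 0 \<le> C x" "\<And>x \<phi>. \<phi> \<in> Cc \<Longrightarrow> (\<phi> x)\<^sup>2 \<le> C x * real_energy b c \<phi>"
    by metis
  obtain n :: nat and o' where
    qvt: "\<And>y. \<exists>j\<in>{1..n}. \<exists>h. graph_automorphism b c h \<and> h y = o' j"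
    using assms(2) unfolding quasi_vertex_transitive_def by blast
  \<comment> \<open>The constants \<open>C x\<close> may be unbounded in \<open>x\<close>, but only
    those at the representatives enter. Being nonnegative, each of them is at most their
    sum.\<close>
  define M where "M = (\<Sum>j\<in>{1..n}. C (o' j))"
  have "(\<phi> y)\<^sup>2 \<le> M * real_energy b c \<phi>" if "\<phi> \<in> Cc" for \<phi> y
  proof -
    obtain j h where j: "j \<in> {1..n}" and h: "graph_automorphism b c h" "h y = o' j"
      using qvt[of y] by blast
    \<comment> \<open>Transporting \<open>\<phi>\<close> by \<open>h\<close> moves its value at
      \<open>y\<close> to the representative \<open>o' j\<close>, keeps the energy, and maps the
      support onto its image under \<open>h\<close>.\<close>
    define \<psi> where "\<psi> = \<phi> \<circ> inv h"
    have bij: "bij h" using h(1) by (simp add: graph_automorphism_def)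
    then have \<psi>h: "\<psi> \<circ> h = \<phi>"
      by (simp add: \<psi>_def comp_assoc bij_is_inj)
    have "{x. \<psi> x \<noteq> 0} \<subseteq> h ` {x. \<phi> x \<noteq> 0}"
      using bij by (auto simp: \<psi>_def image_iff) (metis bij_inv_eq_iff)
    then have "\<psi> \<in> Cc"
      using that finite_subset by (auto simp: Cc_def)
    then have "(\<psi> (h y))\<^sup>2 \<le> C (o' j) * real_energy b c \<psi>"
      using C(2) h(2) by metis
    also have "energy b c \<psi> = energy b c \<phi>"
      using energy_automorphism[OF h(1), of \<psi>] \<psi>h by simp
    also have "\<psi> (h y) = \<phi> y"
      using \<psi>h by (metis comp_apply)
    also have "C (o' j) * real_energy b c \<phi> \<le> M * real_energy b c \<phi>"
      unfolding M_def using j C(1) by (intro mult_right_mono member_le_sum) auto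
    finally show ?thesis .
  qed
  moreover have "0 \<le> M"
    unfolding M_def using C(1) by (intro sum_nonneg)
  ultimately show ?thesis using that by blast
qed

section \<open>Passage to the closure and to the supremum norm\<close>

text \<open>
  The comparison function \<open>\<psi>\<close> below depends on the vertex \<open>x\<close>: convergence in the base point norm
  is a priori only pointwise, and only the bound on \<open>\<psi> - \<phi>\<close> is uniform.
\<close>

lemma uniform_bound_finite_energy0:
  assumes conn: "graph_connected b" and "0 \<le> C"
    and bound: "\<And>\<phi> x. \<phi> \<in> Cc \<Longrightarrow> (\<phi> x)\<^sup>2 \<le> C * real_energy b c \<phi>"
    and f: "f \<in> finite_energy0 b c p" and \<phi>: "\<phi> \<in> Cc"
  shows "(f x - \<phi> x)\<^sup>2 \<le> 4 * C * real_energy b c (\<lambda>x. f x - \<phi> x)"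
proof (rule field_le_epsilon)
  fix e :: real assume "e > 0"
  have fin: "f \<in> finite_energy b c" "\<And>\<psi>. \<psi> \<in> Cc \<Longrightarrow> \<psi> \<in> finite_energy b c"
    using f Cc_subset_finite_energy by (auto simp: finite_energy0_def)
  note diff = finite_energy_diff[OF fin(1) fin(2)]
  obtain K where K: "0 \<le> K" "\<And>g. g \<in> finite_energy b c \<Longrightarrow> (g x - g p)\<^sup>2 \<le> K * real_energy b c g"
    using path_bound[OF conn] by metis
  \<comment> \<open>The errors are \<open>2 * (2 * K * d + 2 * d)\<close> from
    \<open>f - \<psi>\<close> and \<open>2 * (C * (2 * d))\<close> from
    \<open>\<psi> - \<phi>\<close>; together they make exactly \<open>e\<close>.\<close>
  define d where "d = e / (4 * K + 4 + 4 * C)"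
  have den: "0 < 4 * K + 4 + 4 * C"
    using K(1) assms(2) by simp
  then have "0 < d"
    using \<open>e > 0\<close> by (simp add: d_def)
  then obtain \<psi> where \<psi>: "\<psi> \<in> Cc" "real_energy b c (\<lambda>x. f x - \<psi> x) < d" "(f p - \<psi> p)\<^sup>2 < d"
    using finite_energy0_approx[OF f] by blast
  have "((f x - \<psi> x) - (f p - \<psi> p))\<^sup>2 \<le> K * real_energy b c (\<lambda>x. f x - \<psi> x)"
    using K(2)[OF diff(1)[OF \<psi>(1)]] .
  also have "\<dots> \<le> K * d"
    using \<psi>(2) K(1) by (intro mult_left_mono) auto
  finally have "(f x - \<psi> x)\<^sup>2 \<le> 2 * (K * d) + 2 * d"
    using square_diff_le[of "f x - \<psi> x" 0 "f p - \<psi> p"] \<psi>(3) by simp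
  moreover have "(\<psi> x - \<phi> x)\<^sup>2 \<le> C * (2 * d + 2 * real_energy b c (\<lambda>x. f x - \<phi> x))"
  proof -
    have "(\<lambda>x. \<phi> x - \<psi> x) \<in> Cc"
      using \<phi> \<psi>(1) unfolding Cc_def
      by (auto intro: finite_subset[of _ "{x. \<phi> x \<noteq> 0} \<union> {x. \<psi> x \<noteq> 0}"])
    then have "(\<phi> x - \<psi> x)\<^sup>2 \<le> C * real_energy b c (\<lambda>x. \<phi> x - \<psi> x)"
      by (rule bound)
    \<comment> \<open>Write \<open>\<phi> - \<psi>\<close> as
      \<open>(f - \<psi>) - (f - \<phi>)\<close>. This doubling and the final use of
      \<open>square_diff_le\<close> account for the factor 4 in \<open>4 * C\<close>.\<close>
    also have "real_energy b c (\<lambda>x. \<phi> x - \<psi> x) \<le>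
        2 * real_energy b c (\<lambda>x. f x - \<psi> x) + 2 * real_energy b c (\<lambda>x. f x - \<phi> x)"
      using finite_energy_diff(2)[OF diff(1)[OF \<psi>(1)] diff(1)[OF \<phi>]] by simp
    also have "\<dots> \<le> 2 * d + 2 * real_energy b c (\<lambda>x. f x - \<phi> x)"
      using \<psi>(2) by simp
    finally show ?thesis
      using assms(2) by (simp add: power2_commute[of "\<psi> x"] mult_left_mono)
  qed
  ultimately have "(f x - \<phi> x)\<^sup>2 \<le>
      4 * C * real_energy b c (\<lambda>x. f x - \<phi> x) + (4 * K + 4 + 4 * C) * d"
    using square_diff_le[of "f x" "\<phi> x" "\<psi> x"] by (simp add: algebra_simps)
  then show "(f x - \<phi> x)\<^sup>2 \<le> 4 * C * real_energy b c (\<lambda>x. f x - \<phi> x) + e"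
    using den by (simp add: d_def)
qed

lemma uniform_bound_imp_uniformly_transient:
  assumes "graph_connected b" and C: "0 \<le> C"
    and "\<And>\<phi> x. \<phi> \<in> Cc \<Longrightarrow> (\<phi> x)\<^sup>2 \<le> C * real_energy b c \<phi>"
  shows "uniformly_transient b c p"
  unfolding uniformly_transient_def
proof
  fix f assume f: "f \<in> finite_energy0 b c p"
  have "\<exists>\<phi>\<in>Cc. sup_norm (\<lambda>x. f x - \<phi> x) < ennreal e" if "e > 0" for e :: real
  proof -
    \<comment> \<open>Aiming at \<open>e / 2\<close> keeps the supremum strictly below
      \<open>e\<close>, and \<open>4 * C + 1\<close> is positive even for
      \<open>C = 0\<close>.\<close>
    define d where "d = (e / 2)\<^sup>2 / (4 * C + 1)"
    have "0 < d" using that C by (simp add: d_def)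
    then obtain \<phi> where \<phi>: "\<phi> \<in> Cc" "real_energy b c (\<lambda>x. f x - \<phi> x) < d"
      using finite_energy0_approx[OF f] by blast
    have "\<bar>f x - \<phi> x\<bar> \<le> e / 2" for x
    proof -
      have "(f x - \<phi> x)\<^sup>2 \<le> 4 * C * real_energy b c (\<lambda>x. f x - \<phi> x)"
        using assms f \<phi>(1) by (intro uniform_bound_finite_energy0)
      also have "\<dots> \<le> (4 * C + 1) * d"
        using \<phi>(2) C by (intro mult_mono) auto
      also have "\<dots> = (e / 2)\<^sup>2"
        using C by (simp add: d_def)
      finally show ?thesis
        using that by (simp add: abs_le_square_iff[symmetric])
    qed
    then have "sup_norm (\<lambda>x. f x - \<phi> x) \<le> ennreal (e / 2)"
      unfolding sup_norm_def by (intro SUP_least ennreal_leI)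
    also have "\<dots> < ennreal e"
      using that by (simp add: ennreal_less_iff)
    finally show ?thesis using \<phi>(1) by blast
  qed
  then show "f \<in> C0"
    by (simp add: C0_def)
qed

end

theorem corollary2p6:
  fixes b :: "'v \<Rightarrow> 'v \<Rightarrow> real" and c :: "'v \<Rightarrow> real" and p :: 'v
  assumes "countable (UNIV :: 'v set)"
    and "infinite (UNIV :: 'v set)"
    and "weighted_graph b c"
    and "graph_connected b"
    and "quasi_vertex_transitive b c"
    and "transient b c p"
  shows "uniformly_transient b c p"
proof -
  interpret weighted_graph b c by fact
  obtain C where "0 \<le> C" "\<And>\<phi> x. \<phi> \<in> Cc \<Longrightarrow> (\<phi> x)\<^sup>2 \<le> C * real_energy b c \<phi>"
    using quasi_vertex_transitive_imp_uniform_bound[OF assms(4-6)] by blast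
  then show ?thesis
    using uniform_bound_imp_uniformly_transient assms(4) by blast
qed

end
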